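(* Let $E$ be a real Banach space, $P \subset E$ a solid cone (not assumed normal), and let $(X,d)$, $d : X \times X \to E$, be a weakly complete generalized cone rectangular metric space with weight $s \ge 1$. Let $T : X \to X$ be a map. Suppose there are real numbers $\mu, \alpha, \beta, \gamma \ge 0$ with $\mu + \alpha + \beta < 1$, $\mu < \frac{1}{s}$ and $\mu + \gamma < 1$ such that for every $x, y \in X$, $$d(Tx,Ty) \le \mu\, d(x,y) + \alpha\, d(x,Tx) + \beta\, d(y,Ty) + \gamma\, d(y,Tx).$$ Then $T$ has a unique fixed point.
   Context: Let $E$ be a real Banach space. A non-empty closed subset $P \subset E$ is a cone if $P + P \subset P$, $\alpha P \subset P$ for all $\alpha \in [0,\infty)$, and $P \cap (-P) = \{0\}$. The cone is solid if its interior $\mathrm{int}\,P$ is non-empty. For $x,y \in E$, $x \le y$ means $y - x \in P$, and $x \ll y$ means $y - x \in \mathrm{int}\,P$. Let $X$ be a nonempty set and $P \subset E$ a solid cone. A map $d : X \times X \to E$ is a generalized cone rectangular metric if $d(x,y) = d(y,x)$ for all $x,y\in X$ and there exists a least integer $s \ge 1$ such that for all $x,y \in X$ and all distinct elements $u,v \in X \setminus \{x,y\}$: (a) $d(x,y) \ge 0$, i.e. $d(x,y) \in P$; (b) $d(x,y) = 0$ if and only if $x = y$; (c) $d(x,y) \le d(x,u) + s\, d(u,v) + d(v,y)$. The pair $(X,d)$ is then called a generalized cone rectangular metric space and $s$ is its weight. A sequence $(x_n)$ in $X$ is Cauchy if for every $c \gg 0$ there is $N \in \mathbb{N}$ (independent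 of $k$) such that $d(x_n, x_{n+k}) \ll c$ for all $n \ge N$ and all $k \in \mathbb{N}$. A sequence $(x_n)$ converges weakly to $x \in X$ if for every $c \gg 0$ there is $N \in \mathbb{N}$ such that $d(x_n, x) \ll c$ for all $n \ge N$. The space $X$ is weakly complete if every Cauchy sequence in $X$ converges weakly to some point of $X$. *)

theory Defs
  imports "HOL-Analysis.Analysis"
begin

text \<open>
  The library constant \<^const>\<open>cone\<close> only expresses closure under non-negative scaling;
  the cones that order a Banach space are closed, convex and pointed.
\<close>

definition ordering_cone :: "'e::real_normed_vector set \<Rightarrow> bool" where
  "ordering_cone P \<longleftrightarrow>
     P \<noteq> {} \<and> closed P \<and>
     (\<forall>x\<in>P. \<forall>y\<in>P. x + y \<in> P) \<and>
     (\<forall>a\<ge>0. \<forall>x\<in>P. a *\<^sub>R x \<in> P) \<and>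
     P \<inter> uminus ` P = {0}"

definition solid_cone :: "'e::real_normed_vector set \<Rightarrow> bool" where
  "solid_cone P \<longleftrightarrow> ordering_cone P \<and> interior P \<noteq> {}"

definition cone_le :: "'e::real_normed_vector \<Rightarrow> 'e set \<Rightarrow> 'e \<Rightarrow> bool"
    (\<open>(_/ \<preceq>\<^bsub>_\<^esub> _)\<close> [51, 0, 51] 50) where
  "x \<preceq>\<^bsub>P\<^esub> y \<longleftrightarrow> y - x \<in> P"

definition cone_ll :: "'e::real_normed_vector \<Rightarrow> 'e set \<Rightarrow> 'e \<Rightarrow> bool"
    (\<open>(_/ \<lless>\<^bsub>_\<^esub> _)\<close> [51, 0, 51] 50) where
  "x \<lless>\<^bsub>P\<^esub> y \<longleftrightarrow> y - x \<in> interior P"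

definition rectangular_inequality ::
    "'e::real_normed_vector set \<Rightarrow> 'a set \<Rightarrow> ('a \<Rightarrow> 'a \<Rightarrow> 'e) \<Rightarrow> nat \<Rightarrow> bool" where
  "rectangular_inequality P X d s \<longleftrightarrow>
     (\<forall>x\<in>X. \<forall>y\<in>X. \<forall>u\<in>X - {x, y}. \<forall>v\<in>X - {x, y}. u \<noteq> v \<longrightarrow>
        d x y \<preceq>\<^bsub>P\<^esub> d x u + real s *\<^sub>R d u v + d v y)"

text \<open>
  The weight \<open>s\<close> is the least admissible constant. Positivity and the identity of
  indiscernibles do not involve the intermediate points \<open>u\<close>, \<open>v\<close>, so they are required for
  all pairs, including when \<open>X\<close> is too small for such points to exist.
\<close>

definition generalized_cone_rectangular_metric_space ::
    "'e::real_normed_vector set \<Rightarrow> 'a set \<Rightarrow> ('a \<Rightarrow> 'a \<Rightarrow> 'e) \<Rightarrow> nat \<Rightarrow> bool" where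
  "generalized_cone_rectangular_metric_space P X d s \<longleftrightarrow>
     X \<noteq> {} \<and>
     (\<forall>x\<in>X. \<forall>y\<in>X. d x y = d y x) \<and>
     (\<forall>x\<in>X. \<forall>y\<in>X. 0 \<preceq>\<^bsub>P\<^esub> d x y) \<and>
     (\<forall>x\<in>X. \<forall>y\<in>X. d x y = 0 \<longleftrightarrow> x = y) \<and>
     1 \<le> s \<and> rectangular_inequality P X d s \<and>
     (\<forall>t\<ge>1. rectangular_inequality P X d t \<longrightarrow> s \<le> t)"

definition cone_Cauchy ::
    "'e::real_normed_vector set \<Rightarrow> ('a \<Rightarrow> 'a \<Rightarrow> 'e) \<Rightarrow> (nat \<Rightarrow> 'a) \<Rightarrow> bool" where
  "cone_Cauchy P d f \<longleftrightarrow>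
     (\<forall>c. 0 \<lless>\<^bsub>P\<^esub> c \<longrightarrow> (\<exists>N. \<forall>n\<ge>N. \<forall>k. d (f n) (f (n + k)) \<lless>\<^bsub>P\<^esub> c))"

definition converges_weakly ::
    "'e::real_normed_vector set \<Rightarrow> ('a \<Rightarrow> 'a \<Rightarrow> 'e) \<Rightarrow> (nat \<Rightarrow> 'a) \<Rightarrow> 'a \<Rightarrow> bool" where
  "converges_weakly P d f x \<longleftrightarrow>
     (\<forall>c. 0 \<lless>\<^bsub>P\<^esub> c \<longrightarrow> (\<exists>N. \<forall>n\<ge>N. d (f n) x \<lless>\<^bsub>P\<^esub> c))"

definition weakly_complete ::
    "'e::real_normed_vector set \<Rightarrow> 'a set \<Rightarrow> ('a \<Rightarrow> 'a \<Rightarrow> 'e) \<Rightarrow> bool" where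
  "weakly_complete P X d \<longleftrightarrow>
     (\<forall>f. range f \<subseteq> X \<and> cone_Cauchy P d f \<longrightarrow> (\<exists>x\<in>X. converges_weakly P d f x))"

end

theory Submission
  imports Defs
begin

text \<open>
  Fix an interior point \<open>e\<close> of the cone. The gauge \<open>y \<mapsto> inf {t \<ge> 0. y \<le> t e}\<close> is monotone and
  sublinear, and vanishes only at \<open>0\<close> among the points of the cone; composing it with \<open>d\<close>
  reduces the theorem to a real-valued distance \<open>D\<close>.

  For the Picard iterates \<open>x n\<close>, the gap \<open>D (x n) (x (n + 1))\<close> decays geometrically. The
  contraction condition bounds \<open>D (x (n + 1)) (x (n + k + 1))\<close> by \<open>\<mu>\<close> times the same quantity at
  \<open>n\<close>, plus \<open>\<gamma>\<close> times the one for \<open>k - 1\<close>, plus a geometrically small error. Taking suprema over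
  \<open>k\<close>, one step in \<open>n\<close> contracts by \<open>r = \<mu> / (1 - \<gamma>) < 1\<close>. The suprema are finite: the rectangular
  inequality through \<open>x N\<close> and \<open>x (N + k)\<close>, with \<open>N\<close> so large that \<open>s r ^ N < 1\<close>, absorbs
  \<open>D (x 0) (x k)\<close> into the left-hand side.
\<close>

section \<open>The gauge of a solid cone\<close>

text \<open>For \<open>e\<close> interior to a cone \<open>P\<close>, this is the Minkowski
  functional of \<open>e - P\<close>. The condition \<open>0 \<le> t\<close> bounds the set below
  and makes the value nonnegative even for \<open>y\<close> outside the cone.\<close>

definition cone_gauge :: "'e::real_normed_vector set \<Rightarrow> 'e \<Rightarrow> 'e \<Rightarrow> real" where
  "cone_gauge P e y = Inf {t. 0 \<le> t \<and> t *\<^sub>R e - y \<in> P}"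

lemma ordering_cone_add: "ordering_cone P \<Longrightarrow> x \<in> P \<Longrightarrow> y \<in> P \<Longrightarrow> x + y \<in> P"
  by (simp add: ordering_cone_def)

lemma ordering_cone_scale: "ordering_cone P \<Longrightarrow> 0 \<le> a \<Longrightarrow> x \<in> P \<Longrightarrow> a *\<^sub>R x \<in> P"
  by (simp add: ordering_cone_def)

lemma ordering_cone_pointed: "ordering_cone P \<Longrightarrow> x \<in> P \<Longrightarrow> - x \<in> P \<Longrightarrow> x = 0"
  unfolding ordering_cone_def by (metis IntI add.inverse_inverse image_eqI singletonD)

text \<open>The translate of \<open>interior P\<close> by \<open>y\<close> is open and stays inside
  \<open>P\<close>.\<close>

lemma interior_ordering_cone_add:
  assumes "ordering_cone P" "x \<in> interior P" "y \<in> P"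
  shows "x + y \<in> interior P"
proof (rule interiorI)
  show "open ((\<lambda>z. y + z) ` interior P)"
    by (rule open_translation) simp
  show "x + y \<in> (\<lambda>z. y + z) ` interior P"
    using assms(2) by (auto simp: add.commute)
  show "(\<lambda>z. y + z) ` interior P \<subseteq> P"
    using assms(1,3) interior_subset ordering_cone_add by blast
qed

lemma interior_ordering_cone_scale:
  assumes "ordering_cone P" "x \<in> interior P" "0 < a"
  shows "a *\<^sub>R x \<in> interior P"
proof (rule interiorI)
  show "open ((\<lambda>z. a *\<^sub>R z) ` interior P)"
    using assms(3) by (intro open_scaling) auto
  show "a *\<^sub>R x \<in> (\<lambda>z. a *\<^sub>R z) ` interior P"
    using assms(2) by auto
  show "(\<lambda>z. a *\<^sub>R z) ` interior P \<subseteq> P"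
    using assms(1,3) ordering_cone_scale[of P a] interior_subset[of P] by auto
qed

text \<open>The points \<open>e - t *\<^sub>R y\<close> tend to \<open>e\<close> as \<open>t\<close>
  decreases to 0, and the interior is open. Since \<open>y\<close> is arbitrary, an interior point
  of a cone is an order unit.\<close>

lemma interior_minus_small_scale:
  fixes e y :: "'e::real_normed_vector"
  assumes "e \<in> interior P"
  obtains t where "t > 0" "e - t *\<^sub>R y \<in> interior P"
proof -
  have "((\<lambda>t. e - t *\<^sub>R y) \<longlongrightarrow> e - 0 *\<^sub>R y) (at_right 0)"
    by (intro tendsto_intros)
  then have "\<forall>\<^sub>F t in at_right 0. e - t *\<^sub>R y \<in> interior P"
    using assms by (auto dest!: topological_tendstoD[where S = "interior P"])
  then have "\<forall>\<^sub>F t in at_right (0::real). 0 < t \<and> e - t *\<^sub>R y \<in> interior P"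
    using eventually_at_right_less by (rule eventually_elim2) auto
  then show thesis
    using that eventually_happens'[OF trivial_limit_at_right_real] by blast
qed

lemma cone_gauge_le: "0 \<le> t \<Longrightarrow> t *\<^sub>R e - y \<in> P \<Longrightarrow> cone_gauge P e y \<le> t"
  unfolding cone_gauge_def by (rule cInf_lower) (auto intro: bdd_belowI)

text \<open>The set is nonempty because \<open>e\<close> is an order unit, and closed because
  \<open>P\<close> is, so the infimum is a minimum. Monotonicity and sublinearity of the gauge rest
  on this attained bound.\<close>

lemma
  assumes P: "ordering_cone P" and e: "e \<in> interior P"
  shows cone_gauge_nonneg: "0 \<le> cone_gauge P e y"
    and cone_gauge_attained: "cone_gauge P e y *\<^sub>R e - y \<in> P"
proof -
  let ?S = "{t. 0 \<le> t \<and> t *\<^sub>R e - y \<in> P}"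
  obtain t where t: "t > 0" "e - t *\<^sub>R y \<in> interior P"
    using interior_minus_small_scale[OF e] .
  then have "(1 / t) *\<^sub>R (e - t *\<^sub>R y) \<in> P"
    using interior_subset P by (intro ordering_cone_scale) auto
  then have "1 / t \<in> ?S"
    using t(1) by (simp add: scaleR_diff_right)
  then have "?S \<noteq> {}"
    by blast
  moreover have "closed ?S"
  proof -
    have "closed P"
      using P by (simp add: ordering_cone_def)
    then have "closed ((\<lambda>t. t *\<^sub>R e - y) -` P)"
      by (intro closed_vimage continuous_intros)
    then have "closed ({0..} \<inter> (\<lambda>t. t *\<^sub>R e - y) -` P)"
      by (intro closed_Int closed_atLeast)
    then show ?thesis
      by (simp add: Int_def)
  qed
  ultimately have "cone_gauge P e y \<in> ?S"
    unfolding cone_gauge_def by (intro closed_contains_Inf) (auto intro: bdd_belowI)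
  then show "0 \<le> cone_gauge P e y" "cone_gauge P e y *\<^sub>R e - y \<in> P"
    by auto
qed

lemma cone_gauge_mono:
  assumes "ordering_cone P" "e \<in> interior P" "x \<preceq>\<^bsub>P\<^esub> y"
  shows "cone_gauge P e x \<le> cone_gauge P e y"
proof (rule cone_gauge_le)
  have "(cone_gauge P e y *\<^sub>R e - y) + (y - x) \<in> P"
    using assms by (intro ordering_cone_add cone_gauge_attained) (auto simp: cone_le_def)
  then show "cone_gauge P e y *\<^sub>R e - x \<in> P"
    by simp
qed (rule cone_gauge_nonneg[OF assms(1,2)])

lemma cone_gauge_add:
  assumes "ordering_cone P" "e \<in> interior P"
  shows "cone_gauge P e (x + y) \<le> cone_gauge P e x + cone_gauge P e y"
proof (rule cone_gauge_le)
  have "(cone_gauge P e x *\<^sub>R e - x) + (cone_gauge P e y *\<^sub>R e - y) \<in> P"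
    using assms by (intro ordering_cone_add cone_gauge_attained)
  then show "(cone_gauge P e x + cone_gauge P e y) *\<^sub>R e - (x + y) \<in> P"
    by (simp add: algebra_simps)
qed (simp add: assms cone_gauge_nonneg)

lemma cone_gauge_scale:
  assumes "ordering_cone P" "e \<in> interior P" "0 \<le> a"
  shows "cone_gauge P e (a *\<^sub>R x) \<le> a * cone_gauge P e x"
proof (rule cone_gauge_le)
  have "a *\<^sub>R (cone_gauge P e x *\<^sub>R e - x) \<in> P"
    using assms by (intro ordering_cone_scale cone_gauge_attained)
  then show "(a * cone_gauge P e x) *\<^sub>R e - a *\<^sub>R x \<in> P"
    by (simp add: algebra_simps)
qed (simp add: assms cone_gauge_nonneg)

text \<open>An attained value 0 says \<open>- x \<in> P\<close>, and the cone is pointed.\<close>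

lemma cone_gauge_eq_0_iff:
  assumes "ordering_cone P" "e \<in> interior P" "x \<in> P"
  shows "cone_gauge P e x = 0 \<longleftrightarrow> x = 0"
proof
  assume "cone_gauge P e x = 0"
  then have "- x \<in> P"
    using cone_gauge_attained[OF assms(1,2), of x] by simp
  then show "x = 0"
    using assms ordering_cone_pointed by blast
next
  assume "x = 0"
  then have "cone_gauge P e x \<le> 0"
    using assms(3) by (intro cone_gauge_le) auto
  then show "cone_gauge P e x = 0"
    using cone_gauge_nonneg[OF assms(1,2), of x] by simp
qed

text \<open>Carries Cauchy sequences from the gauge to the cone. If \<open>c - t *\<^sub>R e\<close>
  is interior and the gauge of \<open>y\<close> is below \<open>t\<close>, then
  \<open>t *\<^sub>R e - y\<close> lies in \<open>P\<close>, and adding it to an interior point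
  stays in the interior.\<close>

lemma cone_ll_if_cone_gauge_small:
  assumes "ordering_cone P" "e \<in> interior P" "0 \<lless>\<^bsub>P\<^esub> c"
  obtains t where "t > 0" "\<And>y. cone_gauge P e y < t \<Longrightarrow> y \<lless>\<^bsub>P\<^esub> c"
proof -
  obtain t where t: "t > 0" "c - t *\<^sub>R e \<in> interior P"
    using interior_minus_small_scale[of c P e] assms(3) by (auto simp: cone_ll_def)
  have "y \<lless>\<^bsub>P\<^esub> c" if "cone_gauge P e y < t" for y
  proof -
    have "(t - cone_gauge P e y) *\<^sub>R e + (cone_gauge P e y *\<^sub>R e - y) \<in> P"
      using assms(1,2) that interior_subset
      by (intro ordering_cone_add ordering_cone_scale cone_gauge_attained) auto
    then have "(c - t *\<^sub>R e) + (t *\<^sub>R e - y) \<in> interior P"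
      using t(2) assms(1) by (intro interior_ordering_cone_add) (auto simp: algebra_simps)
    then show ?thesis
      by (simp add: cone_ll_def)
  qed
  with t(1) show thesis
    using that by blast
qed

lemma cone_gauge_le_if_cone_ll:
  assumes "0 \<le> t" "y \<lless>\<^bsub>P\<^esub> t *\<^sub>R e"
  shows "cone_gauge P e y \<le> t"
  using assms interior_subset by (intro cone_gauge_le) (auto simp: cone_ll_def)

section \<open>Double sequences with a contractive recursion\<close>

text \<open>A bound on column \<open>k\<close> turns the recursion in column \<open>Suc k\<close>
  into an affine one with slope \<open>\<mu> < 1\<close>.\<close>

lemma double_seq_bounded_columns:
  fixes a :: "nat \<Rightarrow> nat \<Rightarrow> real"
  assumes "0 \<le> \<mu>" "\<mu> < 1" "0 \<le> \<gamma>"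
    and zero: "\<And>n. a n 0 = 0"
    and rec: "\<And>n k. a (Suc n) (Suc k) \<le> \<mu> * a n (Suc k) + \<gamma> * a (Suc n) k + C"
  shows "\<exists>G. \<forall>n. a n k \<le> G"
proof (induction k)
  case 0
  then show ?case
    using zero by auto
next
  case (Suc k)
  then obtain G where G: "\<And>n. a n k \<le> G"
    by blast
  \<comment> \<open>The quotient is the fixed point of the affine map sending \<open>t\<close> to
    \<open>\<mu> * t + \<gamma> * G + C\<close>. A value at or above it is not increased by the map,
    so the bound passes from \<open>n\<close> to \<open>Suc n\<close>.\<close>
  define G' where "G' = max (a 0 (Suc k)) ((\<gamma> * G + C) / (1 - \<mu>))"
  have G': "\<gamma> * G + C \<le> (1 - \<mu>) * G'"
  proof -
    have "(\<gamma> * G + C) / (1 - \<mu>) \<le> G'"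
      by (simp add: G'_def)
    then show ?thesis
      using assms(2) by (simp add: pos_divide_le_eq mult.commute)
  qed
  have "a n (Suc k) \<le> G'" for n
  proof (induction n)
    case (Suc n)
    have "a (Suc n) (Suc k) \<le> \<mu> * G' + \<gamma> * G + C"
      using rec[of n k] mult_left_mono[OF Suc assms(1)] mult_left_mono[OF G[of "Suc n"] assms(3)]
      by linarith
    then show ?case
      using G' by (simp add: algebra_simps)
  qed (simp add: G'_def)
  then show ?case
    by blast
qed

text \<open>The bound solves the recursion with equality, since
  \<open>r = \<mu> / (1 - \<gamma>)\<close> satisfies \<open>r = \<mu> + \<gamma> * r\<close>.
  Truncating at \<open>K\<close> is consistent because the recursion never refers to a larger
  column; it allows \<open>B\<close> to be the maximum of a finite piece of row 0.\<close>

lemma double_seq_row_contraction: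
  fixes a :: "nat \<Rightarrow> nat \<Rightarrow> real"
  assumes "0 \<le> \<mu>" "0 \<le> \<gamma>" "\<mu> + \<gamma> < 1" "0 \<le> B" "0 \<le> C"
    and zero: "\<And>n. a n 0 = 0"
    and rec: "\<And>n k. a (Suc n) (Suc k) \<le> \<mu> * a n (Suc k) + \<gamma> * a (Suc n) k + C"
    and bound: "\<And>k. k \<le> K \<Longrightarrow> a 0 k \<le> B"
    and "k \<le> K"
  shows "a n k \<le> (\<mu> / (1 - \<gamma>)) ^ n * B + C / (1 - \<mu> - \<gamma>)"
  using \<open>k \<le> K\<close>
proof (induction n arbitrary: k)
  case 0
  then show ?case
    using bound[of k] assms(3,5) by (simp add: add_increasing2)
next
  case (Suc n)
  define r D where "r = \<mu> / (1 - \<gamma>)" and "D = C / (1 - \<mu> - \<gamma>)"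
  have r: "r = \<mu> + \<gamma> * r" "0 \<le> r"
    using assms(1,2,3) by (auto simp: r_def field_simps)
  have "D * (1 - \<mu> - \<gamma>) = C"
    using assms(3) by (simp add: D_def)
  then have D: "D = \<mu> * D + \<gamma> * D + C"
    by (simp add: algebra_simps)
  have "0 \<le> D"
    using assms(3,5) by (simp add: D_def)
  have step: "r ^ Suc n * B + D = \<mu> * (r ^ n * B + D) + \<gamma> * (r ^ Suc n * B + D) + C"
  proof -
    have "r ^ Suc n * B = \<mu> * (r ^ n * B) + \<gamma> * (r ^ Suc n * B)"
      using arg_cong[OF r(1), of "\<lambda>t. t * (r ^ n * B)"] by (simp add: distrib_right mult.assoc)
    then show ?thesis
      using D by (simp only: distrib_left)
  qed
  note IH = Suc.IH
  \<comment> \<open>The \<open>\<gamma>\<close> term lies in the same row one column earlier, so an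
    inner induction on \<open>k\<close> is nested in the one on \<open>n\<close>; the
    \<open>\<mu>\<close> term is covered by \<open>IH\<close>.\<close>
  from Suc.prems have "a (Suc n) k \<le> r ^ Suc n * B + D"
  proof (induction k)
    case 0
    then show ?case
      using r(2) \<open>0 \<le> D\<close> assms(4) by (simp add: zero)
  next
    case (Suc k)
    have "a n (Suc k) \<le> r ^ n * B + D"
      using IH[OF Suc.prems] by (simp add: r_def D_def)
    from mult_left_mono[OF this assms(1)] show ?case
      using mult_left_mono[OF Suc.IH assms(2)] rec[of n k] step Suc.prems by simp
  qed
  then show ?case
    by (simp add: r_def D_def)
qed

text \<open>The largest entry of row 0 up to column \<open>K\<close> is compared with itself: it
  reappears on the right with coefficient \<open>s * r ^ N < 1\<close>, and the remainder
  \<open>L\<close> does not depend on \<open>K\<close>. The term \<open>a k N\<close> is controlled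
  by the bound on column \<open>N\<close>.\<close>

lemma double_seq_bounded_row:
  fixes a :: "nat \<Rightarrow> nat \<Rightarrow> real" and s \<mu> \<gamma> C :: real
  assumes "0 \<le> \<mu>" "0 \<le> \<gamma>" "\<mu> + \<gamma> < 1" "0 \<le> C" "0 \<le> s"
    and zero: "\<And>n. a n 0 = 0"
    and nonneg: "\<And>n k. 0 \<le> a n k"
    and rec: "\<And>n k. a (Suc n) (Suc k) \<le> \<mu> * a n (Suc k) + \<gamma> * a (Suc n) k + C"
    and rect: "\<And>N k. 0 < N \<Longrightarrow> N < k \<Longrightarrow> a 0 k \<le> a 0 N + s * a N k + a k N"
  shows "\<exists>B. \<forall>k. a 0 k \<le> B"
proof -
  define r where "r = \<mu> / (1 - \<gamma>)"
  have r: "0 \<le> r" "r < 1"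
    using assms(1,2,3) by (auto simp: r_def field_simps)
  then have "(\<lambda>N. s * r ^ N) \<longlonglongrightarrow> s * 0"
    by (intro tendsto_intros LIMSEQ_power_zero) auto
  then have "\<forall>\<^sub>F N in sequentially. s * r ^ N < 1"
    by (auto dest: order_tendstoD(2)[where a = 1])
  then have "\<forall>\<^sub>F N in sequentially. 0 < N \<and> s * r ^ N < 1"
    using eventually_gt_at_top[of "0::nat"] by (intro eventually_conj)
  then obtain N where N: "0 < N" "s * r ^ N < 1"
    using eventually_happens'[OF sequentially_bot] by blast
  obtain G where G: "\<And>n. a n N \<le> G"
    using double_seq_bounded_columns[of \<mu> \<gamma> a C N, OF _ _ _ zero rec] assms(1-3) by force
  define L where "L = a 0 N + s * (C / (1 - \<mu> - \<gamma>)) + G"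
  \<comment> \<open>The first entry covers the columns up to \<open>N\<close>, where
    \<open>rect\<close> does not apply; the second solves
    \<open>t \<le> L + s * r ^ N * t\<close>.\<close>
  define B where "B = max (Max (a 0 ` {..N})) (L / (1 - s * r ^ N))"
  have "a 0 K \<le> B" for K
  proof -
    \<comment> \<open>With a maximizing \<open>k\<close>, the value \<open>a 0 k\<close> itself
      serves as \<open>B\<close> in the row contraction.\<close>
    obtain k where k: "k \<le> K" "\<And>j. j \<le> K \<Longrightarrow> a 0 j \<le> a 0 k"
    proof -
      have "Max (a 0 ` {..K}) \<in> a 0 ` {..K}"
        by (intro Max_in) auto
      then obtain k where "k \<le> K" "a 0 k = Max (a 0 ` {..K})"
        by force
      then show thesis
        using that[of k] by simp
    qed
    have "a 0 k \<le> B"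
    proof (cases "k \<le> N")
      case True
      then have "a 0 k \<le> Max (a 0 ` {..N})"
        by (intro Max_ge) auto
      then show ?thesis
        by (simp add: B_def)
    next
      case False
      have "a N k \<le> r ^ N * a 0 k + C / (1 - \<mu> - \<gamma>)"
        unfolding r_def
        by (rule double_seq_row_contraction[OF assms(1-3) nonneg assms(4) zero rec k(2,1)])
      from mult_left_mono[OF this assms(5)]
      have "a 0 k \<le> L + s * r ^ N * a 0 k"
        using rect[of N k] False N(1) G[of k] by (simp add: L_def algebra_simps)
      then have "a 0 k \<le> L / (1 - s * r ^ N)"
        using N(2) by (simp add: pos_le_divide_eq algebra_simps)
      then show ?thesis
        by (simp add: B_def)
    qed
    then show ?thesis
      using k(2)[of K] by simp
  qed
  then show ?thesis
    by blast
qed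

text \<open>The bound \<open>H * p ^ n\<close>, uniform in \<open>k\<close>, reproduces itself once
  \<open>C * q ^ n \<le> H * ((1 - \<gamma>) * p - \<mu>) * p ^ n\<close>. So \<open>p\<close> is
  taken above \<open>\<mu> / (1 - \<gamma>)\<close> and above \<open>q\<close>, and \<open>H\<close>
  large enough for this and for row 0.\<close>

lemma double_seq_geometric_decay:
  fixes a :: "nat \<Rightarrow> nat \<Rightarrow> real"
  assumes "0 \<le> \<mu>" "0 \<le> \<gamma>" "\<mu> + \<gamma> < 1" "0 \<le> C" "0 \<le> q" "q < 1"
    and zero: "\<And>n. a n 0 = 0"
    and rec: "\<And>n k. a (Suc n) (Suc k) \<le> \<mu> * a n (Suc k) + \<gamma> * a (Suc n) k + C * q ^ n"
    and bound: "\<And>k. a 0 k \<le> B"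
  shows "\<exists>H p. 0 \<le> p \<and> p < 1 \<and> (\<forall>n k. a n k \<le> H * p ^ n)"
proof -
  have "max q (\<mu> / (1 - \<gamma>)) < 1"
    using assms(1-3,6) by (auto simp: field_simps)
  then obtain p where "max q (\<mu> / (1 - \<gamma>)) < p" "p < 1"
    using dense by blast
  then have p: "q \<le> p" "0 \<le> p" "p < 1" "0 < (1 - \<gamma>) * p - \<mu>"
    using assms(1-3,5) by (auto simp: pos_divide_less_eq mult.commute)
  define H where "H = max B (C / ((1 - \<gamma>) * p - \<mu>))"
  have H: "C \<le> H * ((1 - \<gamma>) * p - \<mu>)"
    using p(4) by (simp add: H_def pos_divide_le_eq[symmetric])
  have "0 \<le> H"
    using bound[of 0] zero by (simp add: H_def)
  have "a n k \<le> H * p ^ n" for n k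
  proof (induction n arbitrary: k)
    case 0
    then show ?case
      using bound[of k] by (simp add: H_def)
  next
    case (Suc n)
    note IH = Suc.IH
    show ?case
    proof (induction k)
      case 0
      then show ?case
        using \<open>0 \<le> H\<close> p(2) by (simp add: zero)
    next
      case (Suc k)
      have "C * q ^ n \<le> H * ((1 - \<gamma>) * p - \<mu>) * p ^ n"
        using H p assms(4,5) by (intro mult_mono power_mono) auto
      then show ?case
        using rec[of n k] mult_left_mono[OF IH[of "Suc k"] assms(1)]
          mult_left_mono[OF Suc.IH assms(2)]
        by (simp add: algebra_simps)
    qed
  qed
  then show ?thesis
    using p(2,3) by blast
qed

section \<open>The fixed point theorem for real-valued distances\<close>

lemma rectangular_contraction_fixed_point:
  fixes D :: "'a \<Rightarrow> 'a \<Rightarrow> real" and s \<mu> \<alpha> \<beta> \<gamma> :: real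
  assumes "X \<noteq> {}"
    and sym: "\<And>x y. x \<in> X \<Longrightarrow> y \<in> X \<Longrightarrow> D x y = D y x"
    and nonneg: "\<And>x y. x \<in> X \<Longrightarrow> y \<in> X \<Longrightarrow> 0 \<le> D x y"
    and zero: "\<And>x y. x \<in> X \<Longrightarrow> y \<in> X \<Longrightarrow> D x y = 0 \<longleftrightarrow> x = y"
    and rect: "\<And>x y u v. \<lbrakk>x \<in> X; y \<in> X; u \<in> X - {x, y}; v \<in> X - {x, y}; u \<noteq> v\<rbrakk>
                 \<Longrightarrow> D x y \<le> D x u + s * D u v + D v y"
    and complete: "\<And>f. \<lbrakk>range f \<subseteq> X; \<And>\<epsilon>. \<epsilon> > 0 \<Longrightarrow> \<exists>N. \<forall>n\<ge>N. \<forall>k. D (f n) (f (n + k)) < \<epsilon>\<rbrakk>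
                     \<Longrightarrow> \<exists>x\<in>X. (\<lambda>n. D (f n) x) \<longlonglongrightarrow> 0"
    and T: "T ` X \<subseteq> X"
    and coeffs: "0 \<le> s" "0 \<le> \<mu>" "0 \<le> \<alpha>" "0 \<le> \<beta>" "0 \<le> \<gamma>" "\<mu> + \<alpha> + \<beta> < 1" "\<mu> + \<gamma> < 1"
    and contr: "\<And>x y. x \<in> X \<Longrightarrow> y \<in> X \<Longrightarrow>
                  D (T x) (T y) \<le> \<mu> * D x y + \<alpha> * D x (T x) + \<beta> * D y (T y) + \<gamma> * D y (T x)"
  shows "\<exists>x\<in>X. T x = x"
proof -
  obtain x0 where "x0 \<in> X"
    using \<open>X \<noteq> {}\<close> by blast
  define x where "x n = (T ^^ n) x0" for n
  have x_Suc: "T (x n) = x (Suc n)" for n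
    by (simp add: x_def)
  have xX: "x n \<in> X" for n
    by (induction n) (use \<open>x0 \<in> X\<close> T in \<open>auto simp: x_def\<close>)
  \<comment> \<open>Applied to consecutive iterates, \<open>contr\<close> loses its
    \<open>\<gamma>\<close> term, because \<open>D (x (Suc n)) (T (x n)) = 0\<close>; solving for
    the next gap gives the ratio \<open>q\<close>.\<close>
  define q where "q = (\<mu> + \<alpha>) / (1 - \<beta>)"
  have q: "0 \<le> q" "q < 1"
    using coeffs by (auto simp: q_def field_simps)
  define g where "g n = D (x n) (x (Suc n))" for n
  have g_nonneg: "0 \<le> g n" for n
    by (simp add: g_def nonneg xX)
  have g_Suc: "g (Suc n) \<le> q * g n" for n
  proof -
    have "g (Suc n) \<le> \<mu> * g n + \<alpha> * g n + \<beta> * g (Suc n)"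
      using contr[OF xX[of n] xX[of "Suc n"]] zero[OF xX[of "Suc n"] xX[of "Suc n"]]
      by (simp add: x_Suc g_def)
    then have "(1 - \<beta>) * g (Suc n) \<le> (\<mu> + \<alpha>) * g n"
      by (simp add: algebra_simps)
    then show ?thesis
      using coeffs by (simp add: q_def field_simps)
  qed
  have g_add: "g (n + m) \<le> q ^ m * g n" for n m
  proof (induction m)
    case (Suc m)
    then show ?case
      using g_Suc[of "n + m"] mult_left_mono[OF Suc q(1)] by (simp add: algebra_simps)
  qed simp
  show ?thesis
  \<comment> \<open>A vanishing gap is a fixed point. Otherwise the orbit is injective, which
    supplies the distinct points that \<open>rect\<close> demands.\<close>
  proof (cases "\<exists>n. g n = 0")
    case True
    then show ?thesis
      using zero xX x_Suc unfolding g_def by metis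
  next
    case False
    \<comment> \<open>A repetition would repeat the gap too, although gaps decay strictly:
      \<open>g n = g m \<le> q ^ (m - n) * g n < g n\<close>.\<close>
    have "x n \<noteq> x m" if "n < m" for n m
    proof
      assume "x n = x m"
      then have "g n = g m"
        by (simp add: g_def flip: x_Suc)
      then have "g n \<le> q ^ (m - n) * g n"
        using g_add[of n "m - n"] that by simp
      moreover have "q ^ (m - n) < 1"
        using q that by (simp add: power_less_one_iff)
      ultimately show False
        using g_nonneg[of n] False
        by (metis less_eq_real_def linorder_not_less mult_less_cancel_right2)
    qed
    then have "inj x"
      by (intro injI) (metis linorder_neqE_nat)
    define a where "a n k = D (x n) (x (n + k))" for n k
    define C where "C = (\<alpha> + \<beta>) * g 0"
    have "0 \<le> C"
      using coeffs g_nonneg by (simp add: C_def)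
    have a_zero: "a n 0 = 0" and a_nonneg: "0 \<le> a n k" for n k
      using zero xX nonneg by (auto simp: a_def)
    have g_geometric: "g (n + k) \<le> q ^ n * g 0" for n k
    proof -
      have "g (n + k) \<le> q ^ (n + k) * g 0"
        using g_add[of 0 "n + k"] by simp
      also have "\<dots> \<le> q ^ n * g 0"
        using q g_nonneg by (intro mult_right_mono power_decreasing) auto
      finally show ?thesis .
    qed
    \<comment> \<open>In \<open>contr\<close> for \<open>x n\<close> and
      \<open>x (n + Suc k)\<close>, the \<open>\<gamma>\<close> term joins
      \<open>x (n + Suc k)\<close> to \<open>x (Suc n)\<close>, an offset of only
      \<open>k\<close>.\<close>
    have a_rec: "a (Suc n) (Suc k) \<le> \<mu> * a n (Suc k) + \<gamma> * a (Suc n) k + C * q ^ n" for n k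
    proof -
      have "a (Suc n) (Suc k)
          \<le> \<mu> * a n (Suc k) + \<alpha> * g n + \<beta> * g (n + Suc k) + \<gamma> * a (Suc n) k"
        using contr[OF xX[of n] xX[of "n + Suc k"]] sym[OF xX[of "n + Suc k"] xX[of "Suc n"]]
        by (simp add: x_Suc g_def a_def)
      moreover have "\<alpha> * g n + \<beta> * g (n + Suc k) \<le> \<alpha> * (q ^ n * g 0) + \<beta> * (q ^ n * g 0)"
        using g_geometric[of n 0] g_geometric[of n "Suc k"] coeffs
        by (intro add_mono mult_left_mono) auto
      ultimately show ?thesis
        by (simp add: C_def algebra_simps)
    qed
    have a_rec': "a (Suc n) (Suc k) \<le> \<mu> * a n (Suc k) + \<gamma> * a (Suc n) k + C" for n k
      using a_rec[of n k] mult_left_mono[OF power_le_one[OF q(1), of n] \<open>0 \<le> C\<close>] q(2) by simp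
    \<comment> \<open>From \<open>0 < N < k\<close> the intermediate points \<open>x N\<close> and
      \<open>x (N + k)\<close> differ from each other and from both ends; the last leg, from
      \<open>x (N + k)\<close> to \<open>x k\<close>, is \<open>a k N\<close>.\<close>
    have a_rect: "a 0 k \<le> a 0 N + s * a N k + a k N" if "0 < N" "N < k" for N k
      using rect[OF xX[of 0] xX[of k], of "x N" "x (N + k)"] that \<open>inj x\<close> xX
        sym[OF xX[of k] xX[of "k + N"]]
      by (simp add: a_def inj_eq add.commute)
    obtain B where B: "\<And>k. a 0 k \<le> B"
      using double_seq_bounded_row[where a = a, OF _ _ _ _ \<open>0 \<le> s\<close> a_zero a_nonneg a_rec' a_rect]
        coeffs \<open>0 \<le> C\<close> by auto
    obtain H p where p: "0 \<le> p" "p < 1" and H: "\<And>n k. a n k \<le> H * p ^ n"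
      using double_seq_geometric_decay[where a = a, OF _ _ _ \<open>0 \<le> C\<close> q a_zero a_rec B] coeffs
      by auto
    have lim0: "(\<lambda>n. H * p ^ n) \<longlonglongrightarrow> 0"
      using p by (intro tendsto_mult_right_zero LIMSEQ_power_zero) auto
    have "\<exists>N. \<forall>n\<ge>N. \<forall>k. D (x n) (x (n + k)) < \<epsilon>" if "\<epsilon> > 0" for \<epsilon>
      using order_tendstoD(2)[OF lim0 that] H unfolding eventually_sequentially a_def
      by (meson le_less_trans)
    then obtain z where z: "z \<in> X" "(\<lambda>n. D (x n) z) \<longlonglongrightarrow> 0"
      using complete[of x] xX by blast
    have Tz: "T z \<in> X"
      using z(1) T by blast
    have g_lim: "g \<longlonglongrightarrow> 0"
      using tendsto_sandwich[OF _ _ tendsto_const lim0, of g] g_nonneg H[of _ 1]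
      by (simp add: a_def g_def)
    have z_lim: "(\<lambda>n. D (x (Suc n)) z) \<longlonglongrightarrow> 0"
      using z(2) by (rule LIMSEQ_Suc)
    \<comment> \<open>An injective sequence visits \<open>w\<close> at most once. Hence
      \<open>x n\<close> and \<open>x (Suc n)\<close> eventually avoid \<open>z\<close> and
      \<open>T z\<close> and may serve as intermediate points between them.\<close>
    have "\<forall>\<^sub>F n in sequentially. x n \<noteq> w" for w
    proof -
      have "finite {n. x n = w}"
        using finite_vimageI[OF _ \<open>inj x\<close>, of "{w}"] by (simp add: vimage_def)
      then show ?thesis
        by (simp flip: cofinite_eq_sequentially add: eventually_cofinite)
    qed
    note ev = this eventually_sequentially_Suc[THEN iffD2, OF this]
    have "\<forall>\<^sub>F n in sequentially. D z (T z) \<le> D (x n) z + s * g n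
        + (\<mu> * D (x n) z + \<alpha> * g n + \<beta> * D z (T z) + \<gamma> * D (x (Suc n)) z)"
      using ev(1)[of z] ev(1)[of "T z"] ev(2)[of z] ev(2)[of "T z"]
    proof eventually_elim
      case (elim n)
      have "D z (T z) \<le> D z (x n) + s * g n + D (x (Suc n)) (T z)"
        using rect[OF z(1) Tz, of "x n" "x (Suc n)"] elim xX \<open>inj x\<close> by (simp add: g_def inj_eq)
      moreover have "D (x (Suc n)) (T z)
          \<le> \<mu> * D (x n) z + \<alpha> * g n + \<beta> * D z (T z) + \<gamma> * D (x (Suc n)) z"
        using contr[OF xX[of n] z(1)] sym[OF z(1) xX[of "Suc n"]] by (simp add: x_Suc g_def)
      ultimately show ?case
        using sym[OF z(1) xX[of n]] by simp
    qed
    moreover have "(\<lambda>n. D (x n) z + s * g n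
        + (\<mu> * D (x n) z + \<alpha> * g n + \<beta> * D z (T z) + \<gamma> * D (x (Suc n)) z))
        \<longlonglongrightarrow> 0 + s * 0 + (\<mu> * 0 + \<alpha> * 0 + \<beta> * D z (T z) + \<gamma> * 0)"
      by (intro tendsto_intros g_lim z z_lim)
    \<comment> \<open>Only the \<open>\<beta>\<close> term survives in the limit, and
      \<open>\<beta> < 1\<close>.\<close>
    ultimately have "D z (T z) \<le> 0 + s * 0 + (\<mu> * 0 + \<alpha> * 0 + \<beta> * D z (T z) + \<gamma> * 0)"
      using tendsto_lowerbound[OF _ _ sequentially_bot] by blast
    then have "(1 - \<beta>) * D z (T z) \<le> 0"
      by (simp add: algebra_simps)
    then have "D z (T z) \<le> 0"
      using coeffs by (simp add: mult_le_0_iff)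
    then have "T z = z"
      using nonneg[OF z(1) Tz] zero[OF z(1) Tz] by simp
    with z(1) show ?thesis
      by blast
  qed
qed

section \<open>Transfer to cone-valued distances\<close>

theorem theorem1:
  fixes P :: "'e::banach set"
    and X :: "'a set"
    and d :: "'a \<Rightarrow> 'a \<Rightarrow> 'e"
    and s :: nat
    and T :: "'a \<Rightarrow> 'a"
    and \<mu> \<alpha> \<beta> \<gamma> :: real
  assumes "solid_cone P"
    and "generalized_cone_rectangular_metric_space P X d s"
    and "weakly_complete P X d"
    and "T ` X \<subseteq> X"
    and "\<mu> \<ge> 0" and "\<alpha> \<ge> 0" and "\<beta> \<ge> 0" and "\<gamma> \<ge> 0"
    and "\<mu> + \<alpha> + \<beta> < 1"
    and "\<mu> < 1 / real s"
    and "\<mu> + \<gamma> < 1"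
    and "\<forall>x\<in>X. \<forall>y\<in>X. d (T x) (T y) \<preceq>\<^bsub>P\<^esub>
           \<mu> *\<^sub>R d x y + \<alpha> *\<^sub>R d x (T x) + \<beta> *\<^sub>R d y (T y) + \<gamma> *\<^sub>R d y (T x)"
  shows "\<exists>!x. x \<in> X \<and> T x = x"
proof -
  obtain e where P: "ordering_cone P" and e: "e \<in> interior P"
    using assms(1) by (auto simp: solid_cone_def)
  let ?\<phi> = "cone_gauge P e"
  define D where "D x y = ?\<phi> (d x y)" for x y
  note gauge_add = cone_gauge_add[OF P e] and gauge_scale = cone_gauge_scale[OF P e]
  have X: "X \<noteq> {}"
    and d_sym: "\<And>x y. x \<in> X \<Longrightarrow> y \<in> X \<Longrightarrow> d x y = d y x"
    and d_mem: "\<And>x y. x \<in> X \<Longrightarrow> y \<in> X \<Longrightarrow> d x y \<in> P"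
    and d_zero: "\<And>x y. x \<in> X \<Longrightarrow> y \<in> X \<Longrightarrow> d x y = 0 \<longleftrightarrow> x = y"
    and d_rect: "rectangular_inequality P X d s"
    using assms(2) by (auto simp: generalized_cone_rectangular_metric_space_def cone_le_def)
  have sym: "D x y = D y x" if "x \<in> X" "y \<in> X" for x y
    by (simp add: D_def d_sym[OF that])
  have nonneg: "0 \<le> D x y" for x y
    by (simp add: D_def cone_gauge_nonneg[OF P e])
  have zero: "D x y = 0 \<longleftrightarrow> x = y" if "x \<in> X" "y \<in> X" for x y
    using that by (simp add: D_def cone_gauge_eq_0_iff[OF P e] d_mem d_zero)
  have rect: "D x y \<le> D x u + real s * D u v + D v y"
    if "x \<in> X" "y \<in> X" "u \<in> X - {x, y}" "v \<in> X - {x, y}" "u \<noteq> v" for x y u v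
  proof -
    have "d x y \<preceq>\<^bsub>P\<^esub> d x u + real s *\<^sub>R d u v + d v y"
      using d_rect that unfolding rectangular_inequality_def by blast
    then have "D x y \<le> ?\<phi> (d x u + real s *\<^sub>R d u v + d v y)"
      unfolding D_def by (rule cone_gauge_mono[OF P e])
    then show ?thesis
      using gauge_add[of "d x u + real s *\<^sub>R d u v" "d v y"]
        gauge_add[of "d x u" "real s *\<^sub>R d u v"] gauge_scale[of "real s" "d u v"]
      by (simp add: D_def)
  qed
  have contr: "D (T x) (T y) \<le> \<mu> * D x y + \<alpha> * D x (T x) + \<beta> * D y (T y) + \<gamma> * D y (T x)"
    if "x \<in> X" "y \<in> X" for x y
  proof -
    have "D (T x) (T y)
        \<le> ?\<phi> (\<mu> *\<^sub>R d x y + \<alpha> *\<^sub>R d x (T x) + \<beta> *\<^sub>R d y (T y) + \<gamma> *\<^sub>R d y (T x))"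
      unfolding D_def using assms(12) that by (intro cone_gauge_mono[OF P e]) auto
    also have "\<dots> \<le> ?\<phi> (\<mu> *\<^sub>R d x y) + ?\<phi> (\<alpha> *\<^sub>R d x (T x)) + ?\<phi> (\<beta> *\<^sub>R d y (T y))
        + ?\<phi> (\<gamma> *\<^sub>R d y (T x))"
      by (intro order_trans[OF gauge_add] add_right_mono order_refl)
    also have "\<dots> \<le> \<mu> * D x y + \<alpha> * D x (T x) + \<beta> * D y (T y) + \<gamma> * D y (T x)"
      unfolding D_def using assms(5-8) by (intro add_mono gauge_scale)
    finally show ?thesis .
  qed
  have complete: "\<exists>x\<in>X. (\<lambda>n. D (f n) x) \<longlonglongrightarrow> 0"
    if f: "range f \<subseteq> X"
      and cauchy: "\<And>\<epsilon>. \<epsilon> > 0 \<Longrightarrow> \<exists>N. \<forall>n\<ge>N. \<forall>k. D (f n) (f (n + k)) < \<epsilon>" for f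
  proof -
    have "cone_Cauchy P d f"
      unfolding cone_Cauchy_def
    proof (intro allI impI)
      fix c
      assume "0 \<lless>\<^bsub>P\<^esub> c"
      then obtain t where "t > 0" "\<And>y. ?\<phi> y < t \<Longrightarrow> y \<lless>\<^bsub>P\<^esub> c"
        using cone_ll_if_cone_gauge_small[OF P e] by metis
      then show "\<exists>N. \<forall>n\<ge>N. \<forall>k. d (f n) (f (n + k)) \<lless>\<^bsub>P\<^esub> c"
        using cauchy[of t] unfolding D_def by blast
    qed
    then obtain z where z: "z \<in> X" "converges_weakly P d f z"
      using assms(3) f unfolding weakly_complete_def by blast
    have "(\<lambda>n. D (f n) z) \<longlonglongrightarrow> 0"
    proof (rule LIMSEQ_I)
      fix \<epsilon> :: real
      assume "\<epsilon> > 0"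
      \<comment> \<open>Lying strictly below \<open>t *\<^sub>R e\<close> yields only gauge
        \<open>\<le> t\<close>; halving \<open>\<epsilon>\<close> restores strictness.\<close>
      then have "0 \<lless>\<^bsub>P\<^esub> (\<epsilon> / 2) *\<^sub>R e"
        using interior_ordering_cone_scale[OF P e, of "\<epsilon> / 2"] by (simp add: cone_ll_def)
      then obtain N where "\<And>n. n \<ge> N \<Longrightarrow> d (f n) z \<lless>\<^bsub>P\<^esub> (\<epsilon> / 2) *\<^sub>R e"
        using z(2) unfolding converges_weakly_def by blast
      then have "D (f n) z \<le> \<epsilon> / 2" if "n \<ge> N" for n
        using that \<open>\<epsilon> > 0\<close> cone_gauge_le_if_cone_ll[of "\<epsilon> / 2" "d (f n) z" P e]
        by (simp add: D_def)
      then show "\<exists>N. \<forall>n\<ge>N. norm (D (f n) z - 0) < \<epsilon>"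
        using \<open>\<epsilon> > 0\<close> nonneg by (intro exI[of _ N]) fastforce
    qed
    with z(1) show ?thesis
      by blast
  qed
  have "\<exists>x\<in>X. T x = x"
  proof (rule rectangular_contraction_fixed_point[where X = X and D = D and s = "real s" and T = T
        and \<mu> = \<mu> and \<alpha> = \<alpha> and \<beta> = \<beta> and \<gamma> = \<gamma>])
    show "\<exists>x\<in>X. (\<lambda>n. D (f n) x) \<longlonglongrightarrow> 0"
      if "range f \<subseteq> X" "\<And>\<epsilon>. \<epsilon> > 0 \<Longrightarrow> \<exists>N. \<forall>n\<ge>N. \<forall>k. D (f n) (f (n + k)) < \<epsilon>" for f
      using that by (rule complete)
  qed (rule X assms(4-9,11) nonneg of_nat_0_le_iff | rule sym zero rect contr; assumption)+
  \<comment> \<open>At two fixed points the \<open>\<alpha>\<close> and \<open>\<beta>\<close> terms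
    vanish, and \<open>\<mu> + \<gamma> < 1\<close> forces distance 0.\<close>
  moreover have "x = y" if "x \<in> X" "y \<in> X" "T x = x" "T y = y" for x y
  proof -
    have "D x y \<le> (\<mu> + \<gamma>) * D x y"
      using contr[OF that(1,2)] zero[OF that(1,1)] zero[OF that(2,2)] sym[OF that(1,2)] that(3,4)
      by (simp add: algebra_simps)
    then have "(1 - (\<mu> + \<gamma>)) * D x y \<le> 0"
      by (simp add: algebra_simps)
    then have "D x y = 0"
      using assms(11) nonneg[of x y] by (auto simp: mult_le_0_iff)
    then show ?thesis
      using zero that by blast
  qed
  ultimately show ?thesis
    by blast
qed

end
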